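(* Let $R_0,R_1,R_2\in\mathbb{C}^{n,n}$ be Hermitian positive semi-definite and let $J\in\mathbb{C}^{n,n}$ be skew-Hermitian. Then the matrix polynomial $Q(\lambda)=\lambda^3R_2+(\lambda^2+\lambda)(R_1+J)+R_0$ is a regular cubic matrix polynomial, hyperstable with respect to the angle $E:=\{z\in\mathbb{C}:-\pi/4<\operatorname{Arg}z<\pi/4\}\setminus\{0\}$.
   Context: The argument of a complex number is taken with $\operatorname{Arg}z\in(-\pi,\pi]$, and $\operatorname{Arg}0:=0$. For a nonempty open or closed $D\subseteq\mathbb{C}$, a matrix polynomial $P(\lambda)$ with coefficients in $\mathbb{C}^{n,n}$ is hyperstable with respect to $D$ if for every $x\in\mathbb{C}^n\setminus\{0\}$ there exists $y\in\mathbb{C}^n\setminus\{0\}$ such that $y^*P(\mu)x\neq0$ for all $\mu\in D$. A matrix polynomial $P(\lambda)$ is regular if $\lambda\mapsto\det P(\lambda)$ is a nonzero scalar polynomial.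
   Formalization: Added: R_0, R_1, R_2, J have no common nonzero kernel vector (all zero is a counterexample otherwise; the condition is necessary for regularity and hyperstability). "Cubic" is read as degree at most 3, exactly 3 if R_2 is nonzero. *)

theory Defs
  imports "HOL-Analysis.Analysis" "HOL-Computational_Algebra.Polynomial"
begin

text \<open>A matrix polynomial is a polynomial whose coefficients are matrices, so \<open>degree\<close> and
  \<open>coeff\<close> have their usual meaning. The evaluation function \<open>poly\<close> must not be used on it:
  the multiplication of the type \<open>complex^'n^'n\<close> is the entrywise one.\<close>

type_synonym 'n mat_poly = "(complex^'n^'n) poly"

definition mp_eval :: "'n::finite mat_poly \<Rightarrow> complex \<Rightarrow> complex^'n^'n" where
  "mp_eval P z = (\<Sum>i\<le>degree P. mat (z ^ i) ** coeff P i)"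

definition adjoint_mat :: "complex^'n^'n \<Rightarrow> complex^'n^'n" where
  "adjoint_mat A = (\<chi> i j. cnj (A $ j $ i))"

definition herm_prod :: "complex^'n::finite \<Rightarrow> complex^'n \<Rightarrow> complex" where
  "herm_prod y w = (\<Sum>i\<in>UNIV. cnj (y $ i) * w $ i)" \<comment> \<open>\<open>y\<^sup>* w\<close>\<close>

definition hermitian_mat :: "complex^'n^'n \<Rightarrow> bool" where
  "hermitian_mat A \<longleftrightarrow> adjoint_mat A = A"

definition skew_hermitian_mat :: "complex^'n^'n \<Rightarrow> bool" where
  "skew_hermitian_mat A \<longleftrightarrow> adjoint_mat A = - A"

text \<open>For Hermitian \<open>A\<close> the number \<open>x\<^sup>* A x\<close> is real, so taking the real part loses nothing.\<close>

definition herm_psd :: "complex^'n::finite^'n \<Rightarrow> bool" where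
  "herm_psd A \<longleftrightarrow> hermitian_mat A \<and> (\<forall>x. 0 \<le> Re (herm_prod x (A *v x)))"

definition regular_mp :: "'n::finite mat_poly \<Rightarrow> bool" where
  "regular_mp P \<longleftrightarrow> (\<exists>p. p \<noteq> 0 \<and> (\<forall>z. det (mp_eval P z) = poly p z))"

definition hyperstable :: "complex set \<Rightarrow> 'n::finite mat_poly \<Rightarrow> bool" where
  "hyperstable D P \<longleftrightarrow> D \<noteq> {} \<and> (open D \<or> closed D) \<and>
     (\<forall>x. x \<noteq> 0 \<longrightarrow> (\<exists>y. y \<noteq> 0 \<and> (\<forall>\<mu>\<in>D. herm_prod y (mp_eval P \<mu> *v x) \<noteq> 0)))"

definition angle_E :: "complex set" where
  "angle_E = {z. - pi / 4 < Arg z \<and> Arg z < pi / 4} - {0}"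

definition cubic_Q ::
  "complex^'n^'n \<Rightarrow> complex^'n^'n \<Rightarrow> complex^'n^'n \<Rightarrow> complex^'n^'n \<Rightarrow> 'n::finite mat_poly" where
  "cubic_Q R\<^sub>0 R\<^sub>1 R\<^sub>2 J = [:R\<^sub>0, R\<^sub>1 + J, R\<^sub>1 + J, R\<^sub>2:]"

text \<open>Positive semi-definiteness alone does not make \<open>cubic_Q\<close> regular (all four matrices may
  vanish): a common kernel vector of \<open>R\<^sub>0, R\<^sub>1, R\<^sub>2, J\<close> is annihilated by every value of the
  polynomial. The next lemmas record that excluding such vectors is necessary both for
  regularity and for hyperstability.\<close>

lemma mp_eval_cubic_Q:
  "mp_eval (cubic_Q R\<^sub>0 R\<^sub>1 R\<^sub>2 J) z =
     mat (z ^ 3) ** R\<^sub>2 + mat (z\<^sup>2 + z) ** (R\<^sub>1 + J) + R\<^sub>0"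
proof -
  let ?Q = "cubic_Q R\<^sub>0 R\<^sub>1 R\<^sub>2 J"
  have "degree ?Q \<le> 3"
    by (auto simp: cubic_Q_def)
  then have "mp_eval ?Q z = (\<Sum>i\<le>3. mat (z ^ i) ** coeff ?Q i)"
    unfolding mp_eval_def
    by (intro sum.mono_neutral_left) (auto simp: coeff_eq_0)
  also have "\<dots> = mat (z ^ 3) ** R\<^sub>2 + mat (z\<^sup>2 + z) ** (R\<^sub>1 + J) + R\<^sub>0"
    by (simp add: cubic_Q_def eval_nat_numeral mat_def matrix_matrix_mult_def vec_eq_iff
        if_distrib if_distribR sum.delta algebra_simps cong: if_cong)
  finally show ?thesis .
qed

lemma mp_eval_cubic_Q_kernel:
  assumes "R\<^sub>0 *v x = 0" "R\<^sub>1 *v x = 0" "R\<^sub>2 *v x = 0" "J *v x = 0"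
  shows "mp_eval (cubic_Q R\<^sub>0 R\<^sub>1 R\<^sub>2 J) z *v x = 0"
  using assms
  by (simp add: mp_eval_cubic_Q matrix_vector_mult_add_rdistrib
      matrix_vector_mul_assoc [symmetric])

lemma regular_cubic_Q_no_common_kernel:
  assumes "regular_mp (cubic_Q R\<^sub>0 R\<^sub>1 R\<^sub>2 J)"
    and "R\<^sub>0 *v x = 0" "R\<^sub>1 *v x = 0" "R\<^sub>2 *v x = 0" "J *v x = 0"
  shows "x = 0"
proof (rule ccontr)
  assume "x \<noteq> 0"
  obtain p where p: "p \<noteq> 0" "\<And>z. det (mp_eval (cubic_Q R\<^sub>0 R\<^sub>1 R\<^sub>2 J) z) = poly p z"
    using assms(1) by (auto simp: regular_mp_def)
  have "poly p z = 0" for z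
    using mp_eval_cubic_Q_kernel [OF assms(2-5), of z] \<open>x \<noteq> 0\<close> p(2)[of z]
      invertible_det_nz matrix_left_invertible_ker invertible_def by metis
  with p(1) show False
    using poly_all_0_iff_0 by blast
qed

lemma hyperstable_cubic_Q_no_common_kernel:
  assumes "hyperstable D (cubic_Q R\<^sub>0 R\<^sub>1 R\<^sub>2 J)"
    and "R\<^sub>0 *v x = 0" "R\<^sub>1 *v x = 0" "R\<^sub>2 *v x = 0" "J *v x = 0"
  shows "x = 0"
  using assms(1) mp_eval_cubic_Q_kernel [OF assms(2-5)]
  by (auto simp: hyperstable_def herm_prod_def)

end

theory Submission imports Defs begin

text \<open>On \<open>angle_E\<close> the numbers \<open>\<lambda>\<^sup>2/(\<lambda> + 1)\<close> and \<open>1/(\<lambda>\<^sup>2 + \<lambda>)\<close> have positive real part. Dividing \<open>x\<^sup>* Q(\<lambda>) x\<close>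
  by \<open>\<lambda>\<^sup>2 + \<lambda>\<close>, one sees that \<open>y = x\<close> is a witness of hyperstability at \<open>x\<close> unless all three numbers
  \<open>x\<^sup>* R\<^sub>i x\<close> vanish. In that case \<open>R\<^sub>i x = 0\<close> by semi-definiteness, so \<open>J x \<noteq> 0\<close>, and \<open>y = J x\<close> is a witness
  because \<open>y\<^sup>* Q(\<lambda>) x = (\<lambda>\<^sup>2 + \<lambda>) (J x)\<^sup>* (J x)\<close>. Hyperstability makes \<open>Q(\<mu>)\<close> injective for each \<open>\<mu>\<close> in \<open>angle_E\<close>,
  so \<open>det Q\<close> is not the zero polynomial.\<close>

section \<open>The Hermitian inner product and semi-definite forms\<close>

lemma herm_prod_add_right: "herm_prod y (v + w) = herm_prod y v + herm_prod y w"
  by (simp add: herm_prod_def sum.distrib algebra_simps)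

lemma herm_prod_scale_right: "herm_prod y (c *s v) = c * herm_prod y v"
  by (simp add: herm_prod_def sum_distrib_left algebra_simps)

lemma herm_prod_zero_right [simp]: "herm_prod y 0 = 0"
  by (simp add: herm_prod_def)

lemma cnj_herm_prod: "cnj (herm_prod y w) = herm_prod w y"
  by (simp add: herm_prod_def mult.commute)

lemma herm_prod_add_left: "herm_prod (v + w) y = herm_prod v y + herm_prod w y"
  by (metis cnj_herm_prod herm_prod_add_right complex_cnj_add)

lemma herm_prod_scale_left: "herm_prod (c *s v) y = cnj c * herm_prod v y"
  by (metis cnj_herm_prod herm_prod_scale_right complex_cnj_mult)

lemma herm_prod_self: "herm_prod v v = of_real (\<Sum>i\<in>UNIV. (cmod (v $ i))\<^sup>2)"
  by (simp only: herm_prod_def of_real_sum complex_norm_square mult.commute)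

lemma herm_prod_self_eq_0_iff [simp]: "herm_prod v v = 0 \<longleftrightarrow> v = 0"
  by (simp add: herm_prod_self sum_nonneg_eq_0_iff vec_eq_iff del: of_real_sum)

lemma herm_prod_adjoint: "herm_prod y (A *v x) = herm_prod (adjoint_mat A *v y) x"
proof -
  have "herm_prod y (A *v x) = (\<Sum>i\<in>UNIV. \<Sum>j\<in>UNIV. cnj (y $ i) * A $ i $ j * x $ j)"
    by (simp add: herm_prod_def matrix_vector_mult_def sum_distrib_left mult.assoc)
  also have "\<dots> = (\<Sum>j\<in>UNIV. \<Sum>i\<in>UNIV. cnj (y $ i) * A $ i $ j * x $ j)"
    by (rule sum.swap)
  also have "\<dots> = herm_prod (adjoint_mat A *v y) x"
    by (simp add: herm_prod_def matrix_vector_mult_def adjoint_mat_def sum_distrib_left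
        sum_distrib_right algebra_simps)
  finally show ?thesis .
qed

lemma hermitian_mat_herm_prod_real:
  assumes "hermitian_mat A"
  shows "herm_prod x (A *v x) = of_real (Re (herm_prod x (A *v x)))"
proof -
  have "herm_prod x (A *v x) = cnj (herm_prod x (A *v x))"
    using herm_prod_adjoint[of x A x] assms by (simp add: hermitian_mat_def cnj_herm_prod)
  then show ?thesis
    by (simp add: complex_eq_iff)
qed

lemma skew_hermitian_mat_Re_herm_prod:
  assumes "skew_hermitian_mat A"
  shows "Re (herm_prod x (A *v x)) = 0"
proof -
  have "adjoint_mat A *v x = (-1) *s (A *v x)"
    using assms by (simp add: skew_hermitian_mat_def matrix_vector_mult_def vec_eq_iff sum_negf)
  then have "herm_prod x (A *v x) = - cnj (herm_prod x (A *v x))"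
    using herm_prod_adjoint[of x A x] by (simp only: herm_prod_scale_left) (simp add: cnj_herm_prod)
  then show ?thesis
    by (simp add: complex_eq_iff)
qed

text \<open>With \<open>v = A *v x\<close>, the form of \<open>A\<close> at \<open>x + t v\<close>
  is a real quadratic in \<open>t\<close> without constant term and with linear coefficient
  \<open>2 * s\<close>, where \<open>s\<close> is the squared norm of \<open>v\<close>. If
  \<open>v\<close> were nonzero, a small negative \<open>t\<close> would make it negative.\<close>

lemma herm_psd_kernel:
  assumes "herm_psd A" and "Re (herm_prod x (A *v x)) = 0"
  shows "A *v x = 0"
proof -
  define v where "v = A *v x"
  define s where "s = Re (herm_prod v v)"
  define c where "c = Re (herm_prod v (A *v v))"
  have herm: "adjoint_mat A = A"
    using assms(1) by (simp add: herm_psd_def hermitian_mat_def)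
  have quad: "0 \<le> 2 * t * s + t\<^sup>2 * c" for t :: real
  proof -
    have "0 \<le> Re (herm_prod (x + of_real t *s v) (A *v (x + of_real t *s v)))"
      using assms(1) by (simp add: herm_psd_def)
    also have "\<dots> = 2 * t * s + t\<^sup>2 * c"
    proof -
      have "A *v (x + of_real t *s v) = v + of_real t *s (A *v v)"
        by (simp add: v_def matrix_vector_right_distrib vector_scalar_commute)
      \<comment> \<open>The other cross term is already the product of \<open>v\<close> with
        \<open>A *v x = v\<close>, so the two together give \<open>2 * t * s\<close>.\<close>
      moreover have "herm_prod x (A *v v) = herm_prod v v"
        by (simp add: herm_prod_adjoint herm flip: v_def)
      ultimately show ?thesis
        using assms(2)
        by (simp add: herm_prod_add_left herm_prod_add_right herm_prod_scale_left
            herm_prod_scale_right s_def c_def power2_eq_square algebra_simps flip: v_def)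
    qed
    finally show ?thesis .
  qed
  have "0 \<le> s" "0 \<le> c"
    using assms(1) by (simp_all add: s_def c_def herm_psd_def herm_prod_self sum_nonneg)
  have "s = 0"
  proof (rule ccontr)
    assume "s \<noteq> 0"
    with \<open>0 \<le> s\<close> have "0 < s" by simp
    \<comment> \<open>The summand 1 keeps the denominator positive when \<open>c = 0\<close>. Any
      positive \<open>t\<close> with \<open>t * c < 2 * s\<close> would do, since
      \<open>quad\<close> is then violated at \<open>- t\<close>.\<close>
    define t where "t = s / (c + 1)"
    have "0 < t" "t * c < 2 * s"
      using \<open>0 < s\<close> \<open>0 \<le> c\<close> by (simp_all add: t_def field_simps add_nonneg_pos)
    then have "t * (t * c - 2 * s) < 0"
      by (simp add: mult_pos_neg)
    with quad[of "- t"] show False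
      by (simp add: power2_eq_square algebra_simps)
  qed
  then have "herm_prod v v = 0"
    by (simp add: s_def herm_prod_self)
  then show ?thesis
    by (simp add: v_def)
qed

section \<open>The angle in Cartesian coordinates\<close>

lemma angle_E_eq: "angle_E = {z. \<bar>Im z\<bar> < Re z}"
proof -
  have "z \<in> angle_E \<longleftrightarrow> \<bar>Im z\<bar> < Re z" for z
  proof (cases "0 < Re z")
    case True
    then have "z \<noteq> 0" by auto
    have Arg: "Arg z = arctan (Im z / Re z)"
      using True by (rule arg_conv_arctan)
    have "- pi / 4 < Arg z \<longleftrightarrow> - 1 < Im z / Re z"
      unfolding Arg using arctan_less_iff[of "- 1"] by (simp add: arctan_minus)
    moreover have "Arg z < pi / 4 \<longleftrightarrow> Im z / Re z < 1"
      unfolding Arg using arctan_less_iff[of _ 1] by simp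
    ultimately show ?thesis
      using True \<open>z \<noteq> 0\<close> by (auto simp: angle_E_def field_simps abs_less_iff)
  next
    case False
    \<comment> \<open>Since \<open>Arg 0 = 0\<close> satisfies both bounds, the origin is excluded
      only by the set difference in \<open>angle_E\<close>. Every other such point has an argument
      of modulus at least pi/2.\<close>
    then have "z \<notin> angle_E"
      using Arg_Re_pos[of z] by (auto simp: angle_E_def)
    with False show ?thesis
      by auto
  qed
  then show ?thesis by blast
qed

lemma open_angle_E: "open angle_E"
  unfolding angle_E_eq by (intro open_Collect_less continuous_intros)

text \<open>Division-free form of the two positivity facts: with q = z^2 + z, the reciprocal of q
  has the sign of Re q in its real part, and z^2/(z + 1) = z^3/q has that of Re (z^3 cnj q).\<close>

lemma angle_E_Re_pos:
  assumes "z \<in> angle_E"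
  shows "0 < Re (z\<^sup>2 + z)" and "0 < Re (z ^ 3 * cnj (z\<^sup>2 + z))"
proof -
  have z: "\<bar>Im z\<bar> < Re z"
    using assms by (simp add: angle_E_eq)
  then have "(Im z)\<^sup>2 < (Re z)\<^sup>2"
    using power_strict_mono[of "\<bar>Im z\<bar>" "Re z" 2] by simp
  then have sq: "0 < Re (z\<^sup>2)"
    by (simp add: power2_eq_square)
  show "0 < Re (z\<^sup>2 + z)"
    using z sq by simp
  have nz: "0 < (cmod z)\<^sup>2"
    using z by auto
  \<comment> \<open>Taking out the factor |z|^2 leaves two summands, each with positive real part on
    the angle.\<close>
  have "z ^ 3 * cnj (z\<^sup>2 + z) = (z * cnj z) * (z * (z * cnj z) + z\<^sup>2)"
    by (simp add: eval_nat_numeral algebra_simps)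
  also have "\<dots> = of_real ((cmod z)\<^sup>2) * (z * of_real ((cmod z)\<^sup>2) + z\<^sup>2)"
    by (simp only: complex_norm_square)
  finally have "Re (z ^ 3 * cnj (z\<^sup>2 + z)) = (cmod z)\<^sup>2 * (Re z * (cmod z)\<^sup>2 + Re (z\<^sup>2))"
    by (simp only: Re_complex_of_real Im_complex_of_real times_complex.sel plus_complex.sel
        mult_zero_left mult_zero_right diff_zero)
  moreover have "0 < Re z * (cmod z)\<^sup>2 + Re (z\<^sup>2)"
    using z sq nz by (intro add_pos_pos mult_pos_pos) auto
  ultimately show "0 < Re (z ^ 3 * cnj (z\<^sup>2 + z))"
    using nz by simp
qed

section \<open>Hyperstability of the cubic\<close>

lemma mat_mult_vector: "mat c *v v = c *s v" for v :: "'a::comm_ring_1^'n::finite"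
  by (simp add: mat_def matrix_vector_mult_def vec_eq_iff if_distrib if_distribR
      cong: if_cong)

lemma herm_prod_mp_eval_cubic_Q:
  "herm_prod y (mp_eval (cubic_Q R\<^sub>0 R\<^sub>1 R\<^sub>2 J) z *v x) =
     z ^ 3 * herm_prod y (R\<^sub>2 *v x) +
     (z\<^sup>2 + z) * (herm_prod y (R\<^sub>1 *v x) + herm_prod y (J *v x)) + herm_prod y (R\<^sub>0 *v x)"
  by (simp add: mp_eval_cubic_Q mat_mult_vector
      herm_prod_add_right herm_prod_scale_right algebra_simps flip: matrix_vector_mul_assoc)

text \<open>After multiplication by cnj q the real part is a combination of \<open>r0\<close>,
  \<open>r1\<close>, \<open>r2\<close> with positive weights. The number \<open>w\<close> drops out
  because its coefficient becomes the real number |q|^2.\<close>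

lemma cubic_form_nonzero:
  fixes z w :: complex and r0 r1 r2 :: real
  assumes "z \<in> angle_E" and "0 \<le> r0" "0 \<le> r1" "0 \<le> r2" and "0 < r0 + r1 + r2" and "Re w = 0"
  shows "z ^ 3 * of_real r2 + (z\<^sup>2 + z) * (of_real r1 + w) + of_real r0 \<noteq> 0"
proof
  define q where "q = z\<^sup>2 + z"
  have q: "0 < Re q" "0 < Re (z ^ 3 * cnj q)"
    using angle_E_Re_pos[OF assms(1)] by (simp_all only: q_def)
  have nq: "0 < (cmod q)\<^sup>2"
    using q by auto
  assume "z ^ 3 * of_real r2 + (z\<^sup>2 + z) * (of_real r1 + w) + of_real r0 = 0"
  then have "0 = (z ^ 3 * of_real r2 + q * (of_real r1 + w) + of_real r0) * cnj q"
    by (simp add: q_def)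
  also have "\<dots> = of_real r2 * (z ^ 3 * cnj q) + (q * cnj q) * (of_real r1 + w) + of_real r0 * cnj q"
    by (simp add: algebra_simps)
  also have "\<dots> = of_real r2 * (z ^ 3 * cnj q) + of_real ((cmod q)\<^sup>2) * (of_real r1 + w)
      + of_real r0 * cnj q"
    by (simp only: complex_norm_square)
  finally have "0 = r2 * Re (z ^ 3 * cnj q) + (cmod q)\<^sup>2 * r1 + r0 * Re q"
    using assms(6)
    by (simp only: complex_eq_iff Re_complex_of_real Im_complex_of_real times_complex.sel
        plus_complex.sel zero_complex.sel cnj.sel) simp
  moreover have "0 \<le> r2 * Re (z ^ 3 * cnj q)" "0 \<le> (cmod q)\<^sup>2 * r1" "0 \<le> r0 * Re q"
    using q nq assms(2-4) by simp_all
  ultimately have "r2 * Re (z ^ 3 * cnj q) = 0" "(cmod q)\<^sup>2 * r1 = 0" "r0 * Re q = 0"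
    by linarith+
  then have "r2 = 0" "r1 = 0" "r0 = 0"
    using q nq by auto
  with assms(5) show False
    by simp
qed

lemma hyperstable_cubic_Q:
  assumes psd: "herm_psd R\<^sub>0" "herm_psd R\<^sub>1" "herm_psd R\<^sub>2" and skew: "skew_hermitian_mat J"
    and no_common_kernel:
      "\<And>x. R\<^sub>0 *v x = 0 \<Longrightarrow> R\<^sub>1 *v x = 0 \<Longrightarrow> R\<^sub>2 *v x = 0 \<Longrightarrow> J *v x = 0 \<Longrightarrow> x = 0"
  shows "hyperstable angle_E (cubic_Q R\<^sub>0 R\<^sub>1 R\<^sub>2 J)"
  unfolding hyperstable_def
proof (intro conjI allI impI)
  have "1 \<in> angle_E"
    by (simp add: angle_E_eq)
  then show "angle_E \<noteq> {}"
    by blast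
  show "open angle_E \<or> closed angle_E"
    using open_angle_E by simp
next
  fix x :: "complex^'a" assume "x \<noteq> 0"
  define r where "r R = Re (herm_prod x (R *v x))" for R :: "complex^'a^'a"
  have nonneg: "0 \<le> r R\<^sub>0" "0 \<le> r R\<^sub>1" "0 \<le> r R\<^sub>2"
    using psd by (simp_all add: r_def herm_psd_def)
  have eq: "herm_prod x (R *v x) = of_real (r R)" if "herm_psd R" for R
    using that hermitian_mat_herm_prod_real by (auto simp: herm_psd_def r_def)
  show "\<exists>y. y \<noteq> 0 \<and>
      (\<forall>\<mu>\<in>angle_E. herm_prod y (mp_eval (cubic_Q R\<^sub>0 R\<^sub>1 R\<^sub>2 J) \<mu> *v x) \<noteq> 0)"
  proof (cases "0 < r R\<^sub>0 + r R\<^sub>1 + r R\<^sub>2")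
    case True
    have "herm_prod x (mp_eval (cubic_Q R\<^sub>0 R\<^sub>1 R\<^sub>2 J) \<mu> *v x) \<noteq> 0" if "\<mu> \<in> angle_E" for \<mu>
      unfolding herm_prod_mp_eval_cubic_Q psd[THEN eq]
      using that nonneg True skew_hermitian_mat_Re_herm_prod[OF skew]
      by (rule cubic_form_nonzero)
    with \<open>x \<noteq> 0\<close> show ?thesis
      by blast
  next
    case False
    with nonneg have "r R\<^sub>0 = 0" "r R\<^sub>1 = 0" "r R\<^sub>2 = 0"
      by linarith+
    then have ker: "R\<^sub>0 *v x = 0" "R\<^sub>1 *v x = 0" "R\<^sub>2 *v x = 0"
      using psd herm_psd_kernel by (simp_all add: r_def)
    \<comment> \<open>Here the absence of a common kernel vector enters: \<open>J\<close> is the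
      only one of the four matrices left that can act nontrivially on \<open>x\<close>.\<close>
    with no_common_kernel \<open>x \<noteq> 0\<close> have "J *v x \<noteq> 0"
      by blast
    moreover have "\<mu>\<^sup>2 + \<mu> \<noteq> 0" if "\<mu> \<in> angle_E" for \<mu>
      using angle_E_Re_pos(1)[OF that] by force
    ultimately show ?thesis
      by (intro exI[of _ "J *v x"]) (simp add: herm_prod_mp_eval_cubic_Q ker)
  qed
qed

section \<open>From hyperstability to regularity\<close>

lemma poly_det:
  fixes M :: "'a::comm_ring_1 poly^'n::finite^'n"
  shows "poly (det M) z = det (\<chi> i j. poly (M $ i $ j) z)"
  by (simp add: det_def poly_sum poly_prod)

lemma det_mp_eval_is_poly: "\<exists>p. \<forall>z. det (mp_eval P z) = poly p z"
proof -
  \<comment> \<open>Viewed as a matrix with polynomial entries, \<open>P\<close> has its determinant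
    in the polynomial ring, and evaluation commutes with it.\<close>
  define M :: "complex poly^'a^'a"
    where "M = (\<chi> i j. \<Sum>k\<le>degree P. monom (coeff P k $ i $ j) k)"
  have "mp_eval P z = (\<chi> i j. poly (M $ i $ j) z)" for z
    by (simp add: M_def mp_eval_def vec_eq_iff poly_sum poly_monom mat_def
        matrix_matrix_mult_def if_distrib if_distribR mult.commute cong: if_cong)
  then show ?thesis
    by (metis poly_det)
qed

lemma hyperstable_imp_regular_mp:
  assumes "hyperstable D P"
  shows "regular_mp P"
proof -
  obtain p where p: "\<And>z. det (mp_eval P z) = poly p z"
    using det_mp_eval_is_poly by blast
  obtain \<mu> where "\<mu> \<in> D"
    using assms by (auto simp: hyperstable_def)
  \<comment> \<open>If \<open>x\<close> were a nonzero kernel vector at this \<open>\<mu>\<close>,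
    every \<open>y\<close> would give the product 0 there.\<close>
  then have "mp_eval P \<mu> *v x \<noteq> 0" if "x \<noteq> 0" for x
    using assms that by (force simp: hyperstable_def)
  then have "det (mp_eval P \<mu>) \<noteq> 0"
    by (metis matrix_left_invertible_ker invertible_left_inverse invertible_det_nz)
  then have "p \<noteq> 0"
    by (auto simp: p)
  with p show ?thesis
    by (auto simp: regular_mp_def)
qed

text \<open>By \<open>regular_cubic_Q_no_common_kernel\<close>, the condition
  \<open>no_common_kernel\<close> is implied by regularity, so it cannot be omitted. "Cubic" is read
  as degree at most 3, because the degree is 3 exactly when \<open>R\<^sub>2\<close> is
  nonzero.\<close>

theorem corollary7p8:
  fixes R\<^sub>0 R\<^sub>1 R\<^sub>2 J :: "complex^'n::finite^'n"
  assumes "herm_psd R\<^sub>0" and "herm_psd R\<^sub>1" and "herm_psd R\<^sub>2"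
    and "skew_hermitian_mat J"
    and no_common_kernel:
      "\<And>x. R\<^sub>0 *v x = 0 \<Longrightarrow> R\<^sub>1 *v x = 0 \<Longrightarrow> R\<^sub>2 *v x = 0 \<Longrightarrow> J *v x = 0 \<Longrightarrow> x = 0"
  shows "regular_mp (cubic_Q R\<^sub>0 R\<^sub>1 R\<^sub>2 J) \<and>
    degree (cubic_Q R\<^sub>0 R\<^sub>1 R\<^sub>2 J) \<le> 3 \<and>
    (R\<^sub>2 \<noteq> 0 \<longrightarrow> degree (cubic_Q R\<^sub>0 R\<^sub>1 R\<^sub>2 J) = 3) \<and>
    hyperstable angle_E (cubic_Q R\<^sub>0 R\<^sub>1 R\<^sub>2 J)"
proof -
  have "hyperstable angle_E (cubic_Q R\<^sub>0 R\<^sub>1 R\<^sub>2 J)"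
    using assms by (rule hyperstable_cubic_Q)
  then show ?thesis
    using hyperstable_imp_regular_mp by (auto simp: cubic_Q_def)
qed

end
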